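(* Let $G$ be a finite weighted graph with vertex set $V$ and graph Laplacian $\mathcal{L}$. If $U\subset V$ is a subset of vertices for which $S=V\setminus U$ is a $\Lambda$-set, then for any $0<\varepsilon<1/\Lambda$ and $k=2^l$, $l\in\mathbb{N}$, there exist weights $\theta_u=\theta_u(U,k,\varepsilon)\in\mathbb{R}$, $u\in U$, such that for every function $f\in\mathbf{E}_\omega(\mathcal{L})$, where $$0<\omega<\frac1\Lambda-\varepsilon,$$ the following relation holds: $$\left|\sum_{v\in V}f(v)-\sum_{u\in U}f(u)\theta_u(U,k,\varepsilon)\right|\to0\quad\text{when } k=2^l\to\infty .$$
   Context: $G$ is an undirected weighted graph with finite vertex set $V=V(G)$ and symmetric weight function $w:V\times V\to[0,\infty)$, $w(u,v)=w(v,u)$, $w(u,u)=0$; pairs with $w(u,v)\neq0$ are edges. $L_2(G)$ is the space of real-valued functions on $V$ with inner product $\langle f,g\rangle=\sum_{v\in V}f(v)g(v)$ and norm $\|f\|=\left(\sum_{v\in V}|f(v)|^2\right)^{1/2}$. The Laplacian is $(\mathcal{L}f)(v)=\sum_{u\in V}(f(v)-f(u))w(v,u)$, a positive-semidefinite self-adjoint operator on $L_2(G)$. $\mathbf{E}_\omega(\mathcal{L})$ is the span of the eigenvectors of $\mathcal{L}$ whose eigenvalues are $\le\omega$. For $S\subset V$, $L_2(S)=\{\varphi\in L_2(G):\varphi(v)=0 \text{ for } v\in V\setminus S\}$. The set $S$ is a $\Lambda$-set, where $\Lambda>0$ is a constant, if $\|\varphi\|\le\Lambda\|\mathcal{L}\varphi\|$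 for all $\varphi\in L_2(S)$. The notation $\theta_u(U,k,\varepsilon)$ stands for $\sum_{v\in V}L^{U,u}_{k,\varepsilon}(v)$, where for $u\in U$ the Lagrangian spline $L^{U,u}_{k,\varepsilon}$ is the unique function $Y\in L_2(G)$ minimizing $\|(\varepsilon I+\mathcal{L})^kY\|$ subject to $Y(v)=\delta_{u,v}$ (Kronecker delta) for all $v\in U$. *)

theory Defs
  imports "HOL-Analysis.Analysis"
begin

text \<open>
  The vertex set \<open>V\<close> is a finite type \<open>'v\<close>, and \<open>L\<^sub>2(G)\<close> is \<open>real ^ 'v\<close>, whose library
  inner product and norm are the unweighted ones \<open>\<Sum>\<^sub>v f(v) g(v)\<close> and
  \<open>(\<Sum>\<^sub>v |f(v)|^2)^(1/2)\<close>.
\<close>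

definition weighted_graph :: "('v::finite \<Rightarrow> 'v \<Rightarrow> real) \<Rightarrow> bool" where
  "weighted_graph w \<longleftrightarrow>
     (\<forall>u v. 0 \<le> w u v) \<and> (\<forall>u v. w u v = w v u) \<and> (\<forall>u. w u u = 0)"

definition laplacian :: "('v::finite \<Rightarrow> 'v \<Rightarrow> real) \<Rightarrow> real ^ 'v \<Rightarrow> real ^ 'v" where
  "laplacian w f = (\<chi> v. \<Sum>u\<in>UNIV. (f $ v - f $ u) * w v u)"

definition eigenspan :: "('v::finite \<Rightarrow> 'v \<Rightarrow> real) \<Rightarrow> real \<Rightarrow> (real ^ 'v) set" where
  "eigenspan w \<omega> = span {f. f \<noteq> 0 \<and> (\<exists>\<mu>\<le>\<omega>. laplacian w f = \<mu> *\<^sub>R f)}"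

definition L2_on :: "'v set \<Rightarrow> (real ^ 'v::finite) set" where
  "L2_on S = {\<phi>. \<forall>v. v \<notin> S \<longrightarrow> \<phi> $ v = 0}"

definition Lambda_set :: "('v::finite \<Rightarrow> 'v \<Rightarrow> real) \<Rightarrow> real \<Rightarrow> 'v set \<Rightarrow> bool" where
  "Lambda_set w \<Lambda> S \<longleftrightarrow>
     0 < \<Lambda> \<and> (\<forall>\<phi>\<in>L2_on S. norm \<phi> \<le> \<Lambda> * norm (laplacian w \<phi>))"

definition shifted_laplacian ::
    "('v::finite \<Rightarrow> 'v \<Rightarrow> real) \<Rightarrow> real \<Rightarrow> real ^ 'v \<Rightarrow> real ^ 'v" where
  "shifted_laplacian w \<epsilon> f = \<epsilon> *\<^sub>R f + laplacian w f"

definition is_lagrangian_spline ::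
    "('v::finite \<Rightarrow> 'v \<Rightarrow> real) \<Rightarrow> 'v set \<Rightarrow> nat \<Rightarrow> real \<Rightarrow> 'v \<Rightarrow> real ^ 'v \<Rightarrow> bool" where
  "is_lagrangian_spline w U k \<epsilon> u Y \<longleftrightarrow>
     is_arg_min (\<lambda>Y. norm ((shifted_laplacian w \<epsilon> ^^ k) Y))
       (\<lambda>Y. \<forall>v\<in>U. Y $ v = (if v = u then 1 else 0)) Y"

definition lagrangian_spline ::
    "('v::finite \<Rightarrow> 'v \<Rightarrow> real) \<Rightarrow> 'v set \<Rightarrow> nat \<Rightarrow> real \<Rightarrow> 'v \<Rightarrow> real ^ 'v" where
  "lagrangian_spline w U k \<epsilon> u = (THE Y. is_lagrangian_spline w U k \<epsilon> u Y)"

definition theta ::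
    "('v::finite \<Rightarrow> 'v \<Rightarrow> real) \<Rightarrow> 'v set \<Rightarrow> nat \<Rightarrow> real \<Rightarrow> 'v \<Rightarrow> real" where
  "theta w U k \<epsilon> u = (\<Sum>v\<in>UNIV. lagrangian_spline w U k \<epsilon> u $ v)"

end

theory Submission
  imports Defs
begin

text \<open>
  Write \<open>A = \<epsilon>I + \<L>\<close> and \<open>S = V \<setminus> U\<close>, and let \<open>k = 2\<^sup>l\<close>. Three facts carry the proof.

  First, \<open>\<L>\<close> is self-adjoint and positive, so adding \<open>\<epsilon>I\<close> can only increase norms and
  \<open>\<parallel>\<phi>\<parallel> \<le> \<Lambda> \<parallel>A \<phi>\<parallel>\<close> on \<open>L\<^sub>2(S)\<close>. For a self-adjoint operator
  \<open>\<parallel>A\<^sup>n\<phi>\<parallel>\<^sup>2 = \<langle>\<phi>, A\<^sup>2\<^sup>n\<phi>\<rangle> \<le> \<parallel>\<phi>\<parallel> \<parallel>A\<^sup>2\<^sup>n\<phi>\<parallel>\<close>, so such an inequality squares itself each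
  time the exponent doubles: \<open>\<parallel>\<phi>\<parallel> \<le> \<Lambda>\<^sup>k \<parallel>A\<^sup>k\<phi>\<parallel>\<close> on \<open>L\<^sub>2(S)\<close>
  (\<open>selfadjoint_lower_bound_doubling\<close>). Doubling is the reason for the exponents \<open>2\<^sup>l\<close>:
  \<open>A\<close> need not map \<open>L\<^sub>2(S)\<close> to itself, so the inequality cannot simply be iterated one
  factor at a time.

  Second, the functions with prescribed values on \<open>U\<close> form a translate of \<open>L\<^sub>2(S)\<close>, and
  minimizing \<open>\<parallel>A\<^sup>k Y\<parallel>\<close> over it is an orthogonal projection problem
  (\<open>ex1_norm_minimizer_on_translate\<close>). Uniqueness holds because \<open>A\<^sup>k\<close> is injective on \<open>L\<^sub>2(S)\<close>
  by the first fact, and the minimizer \<open>Y\<close> is characterized by \<open>A\<^sup>k Y\<close> being orthogonal to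
  \<open>A\<^sup>k L\<^sub>2(S)\<close>. Orthogonality is linear, so it passes to the interpolant
  \<open>s = \<Sum>\<^sub>u f(u) L\<^sub>u\<close>. As \<open>f - s\<close> lies in \<open>L\<^sub>2(S)\<close>, it follows that
  \<open>\<parallel>f - s\<parallel> \<le> \<Lambda>\<^sup>k \<parallel>A\<^sup>k(f - s)\<parallel> \<le> \<Lambda>\<^sup>k \<parallel>A\<^sup>k f\<parallel>\<close>.

  Third, \<open>\<parallel>A\<^sup>k f\<parallel> \<le> C (\<omega> + \<epsilon>)\<^sup>k\<close> for \<open>f\<close> in the span of the eigenvectors with
  eigenvalues at most \<open>\<omega>\<close>. Since \<open>\<Lambda>(\<omega> + \<epsilon>) < 1\<close>, the interpolants converge to \<open>f\<close>, and
  their sums over \<open>V\<close>, which are \<open>\<Sum>\<^sub>u f(u) \<theta>\<^sub>u\<close>, converge to that of \<open>f\<close>.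
\<close>


section \<open>Powers of self-adjoint operators\<close>

lemma linear_funpow:
  fixes A :: "'a::real_vector \<Rightarrow> 'a"
  assumes "linear A"
  shows "linear (A ^^ n)"
proof (induction n)
  case 0
  then show ?case using linear_id by (simp add: id_def)
next
  case (Suc n)
  then show ?case using linear_compose[OF Suc assms] by (simp add: o_def)
qed

lemma selfadjoint_funpow:
  fixes A :: "'a::real_inner \<Rightarrow> 'a"
  assumes "\<And>x y. A x \<bullet> y = x \<bullet> A y"
  shows "(A ^^ n) x \<bullet> y = x \<bullet> (A ^^ n) y"
proof (induction n arbitrary: y)
  case (Suc n)
  have "(A ^^ Suc n) x \<bullet> y = x \<bullet> (A ^^ n) (A y)"
    by (simp add: assms Suc)
  then show ?case by (simp add: funpow_swap1)
qed simp

text \<open>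
  The induction step is Cauchy--Schwarz applied to \<open>\<parallel>B x\<parallel>\<^sup>2 = \<langle>x, B\<^sup>2x\<rangle>\<close> with \<open>B\<close> the power
  reached so far. The bound is used at the single vector \<open>x\<close> only, so it can be applied to
  the members of a subspace that \<open>A\<close> does not preserve, such as \<open>L\<^sub>2(S)\<close>.
\<close>

lemma selfadjoint_lower_bound_doubling:
  fixes A :: "'a::real_inner \<Rightarrow> 'a"
  assumes selfadjoint: "\<And>x y. A x \<bullet> y = x \<bullet> A y"
    and "0 \<le> a" and bound: "norm x \<le> a * norm (A x)"
  shows "norm x \<le> a ^ (2 ^ l) * norm ((A ^^ (2 ^ l)) x)"
proof (induction l)
  case 0
  then show ?case using bound by simp
next
  case (Suc l)
  let ?n = "2 ^ l :: nat"
  have twice: "(A ^^ (2 ^ Suc l)) x = (A ^^ ?n) ((A ^^ ?n) x)"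
    by (simp add: mult_2 funpow_add)
  have "(norm ((A ^^ ?n) x))\<^sup>2 = x \<bullet> (A ^^ (2 ^ Suc l)) x"
    unfolding twice power2_norm_eq_inner by (simp add: selfadjoint_funpow[OF selfadjoint])
  also have "\<dots> \<le> norm x * norm ((A ^^ (2 ^ Suc l)) x)"
    by (rule norm_cauchy_schwarz)
  finally have cs: "(norm ((A ^^ ?n) x))\<^sup>2 \<le> norm x * norm ((A ^^ (2 ^ Suc l)) x)" .
  have "(norm x)\<^sup>2 \<le> (a ^ ?n * norm ((A ^^ ?n) x))\<^sup>2"
    using Suc by (rule power_mono) simp
  also have "\<dots> = a ^ (2 ^ Suc l) * (norm ((A ^^ ?n) x))\<^sup>2"
    by (simp add: power_mult_distrib flip: power_mult) (simp add: mult.commute)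
  also have "\<dots> \<le> a ^ (2 ^ Suc l) * (norm x * norm ((A ^^ (2 ^ Suc l)) x))"
    using cs \<open>0 \<le> a\<close> by (intro mult_left_mono) simp_all
  finally have "norm x * norm x \<le> norm x * (a ^ (2 ^ Suc l) * norm ((A ^^ (2 ^ Suc l)) x))"
    by (simp add: power2_eq_square mult_ac)
  then show ?case
    using \<open>0 \<le> a\<close> by (cases "x = 0") simp_all
qed


section \<open>Minimizing a seminorm over a translate of a subspace\<close>

text \<open>
  If \<open>T Y\<close> is orthogonal to \<open>T K\<close>, then moving \<open>Y\<close> inside its translate of \<open>K\<close> adds a
  nonnegative term to \<open>\<parallel>T Y\<parallel>\<^sup>2\<close> by Pythagoras, and a positive one if \<open>T\<close> is injective on \<open>K\<close>.
\<close>

lemma ex1_norm_minimizer_on_translate: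
  fixes T :: "'a::real_vector \<Rightarrow> 'b::euclidean_space"
  assumes T: "linear T" and K: "subspace K" and inj: "\<And>x. x \<in> K \<Longrightarrow> T x = 0 \<Longrightarrow> x = 0"
  shows "\<exists>!Y. is_arg_min (\<lambda>Y. norm (T Y)) (\<lambda>Y. Y - y\<^sub>0 \<in> K) Y" (is "\<exists>!Y. ?min Y")
    and "is_arg_min (\<lambda>Y. norm (T Y)) (\<lambda>Y. Y - y\<^sub>0 \<in> K) Y \<Longrightarrow> x \<in> K \<Longrightarrow> T Y \<bullet> T x = 0"
proof -
  have "subspace (T ` K)"
    using T K by (rule linear_subspace_image)
  then obtain p z where "p \<in> T ` K" and orth: "\<And>t. t \<in> T ` K \<Longrightarrow> orthogonal z t"
    and "T y\<^sub>0 = p + z"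
    using orthogonal_subspace_decomp_exists[of "T ` K" "T y\<^sub>0"] by (metis span_eq_iff)
  then obtain x\<^sub>0 where "x\<^sub>0 \<in> K" "T y\<^sub>0 = T x\<^sub>0 + z" by auto
  define Z where "Z = y\<^sub>0 - x\<^sub>0"
  have Z_mem: "Z - y\<^sub>0 \<in> K"
    using \<open>x\<^sub>0 \<in> K\<close> K by (simp add: Z_def subspace_neg)
  have TZ: "T Z = z"
    using \<open>T y\<^sub>0 = T x\<^sub>0 + z\<close> by (simp add: Z_def linear_diff[OF T])
  have Z_orth: "T Z \<bullet> T x = 0" if "x \<in> K" for x
    using orth[of "T x"] that by (simp add: TZ orthogonal_def)
  have pythagoras: "(norm (T Y))\<^sup>2 = (norm (T Z))\<^sup>2 + (norm (T (Y - Z)))\<^sup>2"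
    and diff_mem: "Y - Z \<in> K" if "Y - y\<^sub>0 \<in> K" for Y
  proof -
    show "Y - Z \<in> K"
      using subspace_diff[OF K that Z_mem] by simp
    then show "(norm (T Y))\<^sup>2 = (norm (T Z))\<^sup>2 + (norm (T (Y - Z)))\<^sup>2"
      using norm_add_Pythagorean[of "T Z" "T (Y - Z)"] Z_orth[of "Y - Z"]
      by (simp add: orthogonal_def linear_diff[OF T])
  qed
  have "norm (T Z) \<le> norm (T Y)" if "Y - y\<^sub>0 \<in> K" for Y
    by (rule power2_le_imp_le) (simp_all add: pythagoras[OF that])
  then have Z_min: "?min Z"
    using Z_mem by (auto simp: is_arg_min_linorder)
  have unique: "Y = Z" if "?min Y" for Y
  proof -
    have Y: "Y - y\<^sub>0 \<in> K" and "norm (T Y) \<le> norm (T Z)"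
      using that Z_mem by (auto simp: is_arg_min_linorder)
    then have "(norm (T Y))\<^sup>2 \<le> (norm (T Z))\<^sup>2"
      by (intro power_mono) simp_all
    then have "T (Y - Z) = 0"
      by (simp add: pythagoras[OF Y])
    then show "Y = Z"
      using inj[OF diff_mem[OF Y]] by simp
  qed
  show "\<exists>!Y. ?min Y"
    using Z_min unique by blast
  show "T Y \<bullet> T x = 0" if "?min Y" "x \<in> K"
    using unique[OF that(1)] Z_orth[OF that(2)] by simp
qed


section \<open>The graph Laplacian and its positive shifts\<close>

lemma linear_laplacian: "linear (laplacian w)"
  by (rule linearI)
    (simp_all add: laplacian_def vec_eq_iff sum.distrib[symmetric] sum_distrib_left algebra_simps)

lemma linear_shifted_laplacian: "linear (shifted_laplacian w \<epsilon>)"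
  by (rule linearI)
    (simp_all add: shifted_laplacian_def linear_add[OF linear_laplacian]
      linear_scale[OF linear_laplacian] algebra_simps)

text \<open>
  Summation by parts: averaging the double sum with its copy under the exchange of
  \<open>u\<close> and \<open>v\<close> gives the Dirichlet form, which is visibly symmetric and positive.
\<close>

lemma laplacian_inner_eq_dirichlet_form:
  assumes "weighted_graph w"
  shows "laplacian w f \<bullet> g =
    (\<Sum>v\<in>UNIV. \<Sum>u\<in>UNIV. (f $ v - f $ u) * (g $ v - g $ u) * w v u) / 2"
proof -
  have w_sym: "w u v = w v u" for u v
    using assms by (simp add: weighted_graph_def)
  have *: "laplacian w f \<bullet> g = (\<Sum>v\<in>UNIV. \<Sum>u\<in>UNIV. (f $ v - f $ u) * g $ v * w v u)"
    by (simp add: inner_vec_def laplacian_def sum_distrib_left mult_ac)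
  also have "\<dots> = (\<Sum>v\<in>UNIV. \<Sum>u\<in>UNIV. (f $ u - f $ v) * g $ u * w u v)"
    by (rule sum.swap)
  also have "\<dots> = (\<Sum>v\<in>UNIV. \<Sum>u\<in>UNIV. - ((f $ v - f $ u) * g $ u * w v u))"
    by (simp add: w_sym algebra_simps)
  finally have "2 * (laplacian w f \<bullet> g) =
      (\<Sum>v\<in>UNIV. \<Sum>u\<in>UNIV. (f $ v - f $ u) * g $ v * w v u) +
      (\<Sum>v\<in>UNIV. \<Sum>u\<in>UNIV. - ((f $ v - f $ u) * g $ u * w v u))"
    using * by simp
  also have "\<dots> = (\<Sum>v\<in>UNIV. \<Sum>u\<in>UNIV. (f $ v - f $ u) * (g $ v - g $ u) * w v u)"
    by (simp add: sum.distrib[symmetric] algebra_simps)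
  finally show ?thesis by simp
qed

lemma laplacian_selfadjoint:
  "weighted_graph w \<Longrightarrow> laplacian w f \<bullet> g = f \<bullet> laplacian w g"
  by (simp add: laplacian_inner_eq_dirichlet_form inner_commute[of f "laplacian w g"] mult_ac)

lemma laplacian_inner_self_nonneg:
  assumes "weighted_graph w"
  shows "0 \<le> laplacian w f \<bullet> f"
  using assms unfolding laplacian_inner_eq_dirichlet_form[OF assms]
  by (auto simp: weighted_graph_def intro!: sum_nonneg)

lemma shifted_laplacian_selfadjoint:
  "weighted_graph w \<Longrightarrow> shifted_laplacian w \<epsilon> f \<bullet> g = f \<bullet> shifted_laplacian w \<epsilon> g"
  by (simp add: shifted_laplacian_def inner_add laplacian_selfadjoint)

lemma norm_laplacian_le_shifted:
  assumes "weighted_graph w" "0 \<le> \<epsilon>"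
  shows "norm (laplacian w f) \<le> norm (shifted_laplacian w \<epsilon> f)"
proof (rule power2_le_imp_le)
  have "(norm (shifted_laplacian w \<epsilon> f))\<^sup>2 =
      (norm (laplacian w f))\<^sup>2 + (2 * \<epsilon> * (laplacian w f \<bullet> f) + \<epsilon>\<^sup>2 * (norm f)\<^sup>2)"
    unfolding shifted_laplacian_def power2_norm_eq_inner
    by (simp add: inner_add inner_commute[of f "laplacian w f"] power2_eq_square algebra_simps)
  then show "(norm (laplacian w f))\<^sup>2 \<le> (norm (shifted_laplacian w \<epsilon> f))\<^sup>2"
    using assms laplacian_inner_self_nonneg[OF assms(1), of f] by simp
qed simp

lemma laplacian_eigenvalue_nonneg:
  assumes "weighted_graph w" "laplacian w f = \<mu> *\<^sub>R f" "f \<noteq> 0"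
  shows "0 \<le> \<mu>"
proof -
  have "0 < f \<bullet> f"
    using assms(3) by simp
  moreover have "0 \<le> \<mu> * (f \<bullet> f)"
    using laplacian_inner_self_nonneg[OF assms(1), of f] assms(2) by simp
  ultimately show ?thesis
    using zero_le_mult_iff[of \<mu> "f \<bullet> f"] by linarith
qed

lemma subspace_L2_on: "subspace (L2_on S)"
  by (auto simp: L2_on_def subspace_def)

lemma Lambda_set_norm_le_shifted_power:
  assumes "weighted_graph w" "Lambda_set w \<Lambda> S" "0 \<le> \<epsilon>" "\<phi> \<in> L2_on S"
  shows "norm \<phi> \<le> \<Lambda> ^ (2 ^ l) * norm ((shifted_laplacian w \<epsilon> ^^ (2 ^ l)) \<phi>)"
proof (rule selfadjoint_lower_bound_doubling)
  show "0 \<le> \<Lambda>"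
    using assms(2) by (simp add: Lambda_set_def)
  have "norm \<phi> \<le> \<Lambda> * norm (laplacian w \<phi>)"
    using assms(2,4) by (simp add: Lambda_set_def)
  also have "\<dots> \<le> \<Lambda> * norm (shifted_laplacian w \<epsilon> \<phi>)"
    using \<open>0 \<le> \<Lambda>\<close> norm_laplacian_le_shifted[OF assms(1,3)] by (intro mult_left_mono)
  finally show "norm \<phi> \<le> \<Lambda> * norm (shifted_laplacian w \<epsilon> \<phi>)" .
qed (rule shifted_laplacian_selfadjoint[OF assms(1)])

text \<open>
  The functions with such a bound form a subspace, because the constant may depend on the
  function; hence it is enough to check eigenvectors. For these, positivity of \<open>\<L>\<close> rules out
  large negative eigenvalues, which would otherwise contribute large \<open>\<bar>\<mu> + \<epsilon>\<bar>\<close>.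
\<close>

lemma eigenspan_shifted_power_bound:
  assumes "weighted_graph w" "0 \<le> \<epsilon>" "f \<in> eigenspan w \<omega>"
  shows "\<exists>C. \<forall>k. norm ((shifted_laplacian w \<epsilon> ^^ k) f) \<le> C * \<bar>\<omega> + \<epsilon>\<bar> ^ k"
proof -
  let ?A = "shifted_laplacian w \<epsilon>"
  let ?P = "{f. \<exists>C. \<forall>k. norm ((?A ^^ k) f) \<le> C * \<bar>\<omega> + \<epsilon>\<bar> ^ k}"
  have lin: "linear (?A ^^ k)" for k
    by (rule linear_funpow) (rule linear_shifted_laplacian)
  have "subspace ?P"
    unfolding subspace_def
  proof (intro conjI ballI allI)
    show "0 \<in> ?P"
      by (auto simp: linear_0[OF lin] intro!: exI[of _ 0])
  next
    fix f g assume "f \<in> ?P" "g \<in> ?P"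
    then obtain C D where "\<And>k. norm ((?A ^^ k) f) \<le> C * \<bar>\<omega> + \<epsilon>\<bar> ^ k"
      and "\<And>k. norm ((?A ^^ k) g) \<le> D * \<bar>\<omega> + \<epsilon>\<bar> ^ k" by auto
    then have "norm ((?A ^^ k) (f + g)) \<le> (C + D) * \<bar>\<omega> + \<epsilon>\<bar> ^ k" for k
      unfolding linear_add[OF lin] distrib_right by (rule norm_add_rule_thm)
    then show "f + g \<in> ?P" by auto
  next
    fix c f assume "f \<in> ?P"
    then obtain C where "\<And>k. norm ((?A ^^ k) f) \<le> C * \<bar>\<omega> + \<epsilon>\<bar> ^ k" by auto
    then have "norm ((?A ^^ k) (c *\<^sub>R f)) \<le> (\<bar>c\<bar> * C) * \<bar>\<omega> + \<epsilon>\<bar> ^ k" for k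
      by (simp add: linear_scale[OF lin] mult.assoc mult_left_mono)
    then show "c *\<^sub>R f \<in> ?P" by blast
  qed
  moreover have "{f. f \<noteq> 0 \<and> (\<exists>\<mu>\<le>\<omega>. laplacian w f = \<mu> *\<^sub>R f)} \<subseteq> ?P"
  proof clarify
    fix f \<mu> assume "f \<noteq> 0" "\<mu> \<le> \<omega>" and eigen: "laplacian w f = \<mu> *\<^sub>R f"
    then have "0 \<le> \<mu>"
      using laplacian_eigenvalue_nonneg[OF assms(1)] by blast
    have "(?A ^^ k) f = (\<mu> + \<epsilon>) ^ k *\<^sub>R f" for k
    proof (induction k)
      case (Suc k)
      then show ?case
        by (simp add: linear_scale[OF linear_shifted_laplacian])
          (simp add: shifted_laplacian_def eigen algebra_simps)
    qed simp
    then have "norm ((?A ^^ k) f) \<le> norm f * \<bar>\<omega> + \<epsilon>\<bar> ^ k" for k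
      using \<open>0 \<le> \<mu>\<close> \<open>\<mu> \<le> \<omega>\<close> \<open>0 \<le> \<epsilon>\<close>
      by (simp add: power_abs mult.commute[of "norm f"] mult_right_mono power_mono)
    then show "\<exists>C. \<forall>k. norm ((?A ^^ k) f) \<le> C * \<bar>\<omega> + \<epsilon>\<bar> ^ k" by blast
  qed
  ultimately have "eigenspan w \<omega> \<subseteq> ?P"
    unfolding eigenspan_def by (intro span_minimal)
  then show ?thesis using assms(3) by auto
qed


section \<open>Lagrangian splines and the interpolation error\<close>

lemma is_lagrangian_spline_iff_minimizer_on_translate:
  assumes "u \<in> U"
  shows "is_lagrangian_spline w U k \<epsilon> u Y \<longleftrightarrow>
    is_arg_min (\<lambda>Y. norm ((shifted_laplacian w \<epsilon> ^^ k) Y))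
      (\<lambda>Y. Y - axis u 1 \<in> L2_on (UNIV - U)) Y"
proof -
  have "(\<forall>v\<in>U. Y $ v = (if v = u then 1 else 0)) \<longleftrightarrow> Y - axis u 1 \<in> L2_on (UNIV - U)" for Y
    by (auto simp: L2_on_def axis_def)
  then show ?thesis
    unfolding is_lagrangian_spline_def by simp
qed

text \<open>
  Everything follows from the projection argument above, with the translate of \<open>L\<^sub>2(S)\<close>
  through the indicator function of \<open>u\<close>. The lower bound for \<open>A\<^sup>k\<close> on \<open>L\<^sub>2(S)\<close> supplies the
  injectivity on which uniqueness rests.
\<close>

lemma
  assumes "weighted_graph w" "Lambda_set w \<Lambda> (UNIV - U)" "0 \<le> \<epsilon>" "u \<in> U"
  shows ex1_lagrangian_spline: "\<exists>!Y. is_lagrangian_spline w U (2 ^ l) \<epsilon> u Y" (is "?ex1")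
    and lagrangian_spline_orthogonal: "\<phi> \<in> L2_on (UNIV - U) \<Longrightarrow>
      (shifted_laplacian w \<epsilon> ^^ (2 ^ l)) (lagrangian_spline w U (2 ^ l) \<epsilon> u) \<bullet>
      (shifted_laplacian w \<epsilon> ^^ (2 ^ l)) \<phi> = 0"
    and lagrangian_spline_nodes: "v \<in> U \<Longrightarrow>
      lagrangian_spline w U (2 ^ l) \<epsilon> u $ v = (if v = u then 1 else 0)"
proof -
  let ?T = "shifted_laplacian w \<epsilon> ^^ (2 ^ l)"
  have T: "linear ?T"
    by (rule linear_funpow) (rule linear_shifted_laplacian)
  have inj: "\<phi> = 0" if "\<phi> \<in> L2_on (UNIV - U)" "?T \<phi> = 0" for \<phi>
    using Lambda_set_norm_le_shifted_power[OF assms(1-3) that(1), of l] that(2) by simp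
  note min = ex1_norm_minimizer_on_translate[OF T subspace_L2_on inj]
  show ?ex1
    unfolding is_lagrangian_spline_iff_minimizer_on_translate[OF assms(4)] by (rule min(1))
  then have spline: "is_lagrangian_spline w U (2 ^ l) \<epsilon> u (lagrangian_spline w U (2 ^ l) \<epsilon> u)"
    unfolding lagrangian_spline_def by (rule theI')
  then show "v \<in> U \<Longrightarrow> lagrangian_spline w U (2 ^ l) \<epsilon> u $ v = (if v = u then 1 else 0)"
    by (simp add: is_lagrangian_spline_def is_arg_min_def)
  show "\<phi> \<in> L2_on (UNIV - U) \<Longrightarrow> ?T (lagrangian_spline w U (2 ^ l) \<epsilon> u) \<bullet> ?T \<phi> = 0"
    by (rule min(2)[OF _ _ spline[unfolded
            is_lagrangian_spline_iff_minimizer_on_translate[OF assms(4)]]])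
qed

text \<open>
  The error \<open>f - s\<close> vanishes on \<open>U\<close>, so the lower bound for \<open>A\<^sup>k\<close> on \<open>L\<^sub>2(S)\<close> applies to it;
  and \<open>A\<^sup>k(f - s)\<close> is an orthogonal projection of \<open>A\<^sup>k f\<close>, hence no longer than \<open>A\<^sup>k f\<close>.
\<close>

lemma spline_interpolation_error:
  assumes "weighted_graph w" "Lambda_set w \<Lambda> (UNIV - U)" "0 \<le> \<epsilon>"
  shows "norm (f - (\<Sum>u\<in>U. f $ u *\<^sub>R lagrangian_spline w U (2 ^ l) \<epsilon> u)) \<le>
    \<Lambda> ^ (2 ^ l) * norm ((shifted_laplacian w \<epsilon> ^^ (2 ^ l)) f)"
proof -
  let ?T = "shifted_laplacian w \<epsilon> ^^ (2 ^ l)"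
  let ?L = "lagrangian_spline w U (2 ^ l) \<epsilon>"
  define s where "s = (\<Sum>u\<in>U. f $ u *\<^sub>R ?L u)"
  have T: "linear ?T"
    by (rule linear_funpow) (rule linear_shifted_laplacian)
  have "s $ v = f $ v" if "v \<in> U" for v
  proof -
    have "s $ v = (\<Sum>u\<in>U. f $ u * (if v = u then 1 else 0))"
      unfolding s_def sum_component using that
      by (intro sum.cong) (simp_all add: lagrangian_spline_nodes[OF assms])
    then show ?thesis
      using that by (simp add: sum.delta' if_distrib cong: if_cong)
  qed
  then have mem: "f - s \<in> L2_on (UNIV - U)"
    by (simp add: L2_on_def)
  have "?T s \<bullet> ?T (f - s) = 0"
    using lagrangian_spline_orthogonal[OF assms _ mem]
    by (simp add: s_def linear_sum[OF T] linear_scale[OF T] inner_sum_left)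
  then have "(norm (?T (f - s)))\<^sup>2 + (norm (?T s))\<^sup>2 = (norm (?T f))\<^sup>2"
    using norm_add_Pythagorean[of "?T (f - s)" "?T s"]
    by (simp add: orthogonal_def inner_commute linear_diff[OF T])
  then have "(norm (?T (f - s)))\<^sup>2 \<le> (norm (?T f))\<^sup>2"
    using zero_le_power2[of "norm (?T s)"] by linarith
  then have proj: "norm (?T (f - s)) \<le> norm (?T f)"
    by (rule power2_le_imp_le) simp
  have "norm (f - s) \<le> \<Lambda> ^ (2 ^ l) * norm (?T (f - s))"
    using assms mem by (rule Lambda_set_norm_le_shifted_power)
  also have "\<dots> \<le> \<Lambda> ^ (2 ^ l) * norm (?T f)"
    using proj assms(2) by (intro mult_left_mono) (simp_all add: Lambda_set_def)
  finally show ?thesis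
    by (simp add: s_def)
qed

lemma splines_converge_on_eigenspan:
  assumes "weighted_graph w" "Lambda_set w \<Lambda> (UNIV - U)" "0 \<le> \<epsilon>"
    and "0 < \<omega>" "\<omega> < 1 / \<Lambda> - \<epsilon>" and f: "f \<in> eigenspan w \<omega>"
  shows "(\<lambda>l. f - (\<Sum>u\<in>U. f $ u *\<^sub>R lagrangian_spline w U (2 ^ l) \<epsilon> u)) \<longlonglongrightarrow> 0"
proof -
  have "0 < \<Lambda>"
    using assms(2) by (simp add: Lambda_set_def)
  obtain C where C: "\<And>k. norm ((shifted_laplacian w \<epsilon> ^^ k) f) \<le> C * (\<omega> + \<epsilon>) ^ k"
    using eigenspan_shifted_power_bound[OF assms(1,3) f] \<open>0 < \<omega>\<close> \<open>0 \<le> \<epsilon>\<close> by auto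
  define q where "q = \<Lambda> * (\<omega> + \<epsilon>)"
  have "0 \<le> q" "q < 1"
    using assms(3-5) \<open>0 < \<Lambda>\<close> by (auto simp: q_def field_simps)
  have "strict_mono (\<lambda>l. 2 ^ l :: nat)"
    by (rule strict_monoI) simp
  then have "(\<lambda>l. q ^ (2 ^ l)) \<longlonglongrightarrow> 0"
    using LIMSEQ_subseq_LIMSEQ[OF LIMSEQ_power_zero[of q]] \<open>0 \<le> q\<close> \<open>q < 1\<close>
    by (simp add: o_def)
  then have lim: "(\<lambda>l. C * q ^ (2 ^ l)) \<longlonglongrightarrow> 0"
    by (rule tendsto_mult_right_zero)
  have "norm (f - (\<Sum>u\<in>U. f $ u *\<^sub>R lagrangian_spline w U (2 ^ l) \<epsilon> u)) \<le> C * q ^ (2 ^ l)" for l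
  proof -
    have "norm (f - (\<Sum>u\<in>U. f $ u *\<^sub>R lagrangian_spline w U (2 ^ l) \<epsilon> u)) \<le>
        \<Lambda> ^ (2 ^ l) * norm ((shifted_laplacian w \<epsilon> ^^ (2 ^ l)) f)"
      by (rule spline_interpolation_error[OF assms(1-3)])
    also have "\<dots> \<le> \<Lambda> ^ (2 ^ l) * (C * (\<omega> + \<epsilon>) ^ (2 ^ l))"
      using \<open>0 < \<Lambda>\<close> C by (intro mult_left_mono) simp_all
    finally show ?thesis
      by (simp add: q_def power_mult_distrib mult_ac)
  qed
  then show ?thesis
    by (intro Lim_null_comparison[OF _ lim] always_eventually allI)
qed

theorem theorem4p1:
  fixes w :: "'v::finite \<Rightarrow> 'v \<Rightarrow> real" and U :: "'v set" and \<Lambda> \<epsilon> :: real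
  assumes "weighted_graph w"
    and "Lambda_set w \<Lambda> (UNIV - U)"
    and "0 < \<epsilon>" and "\<epsilon> < 1 / \<Lambda>"
  shows "(\<forall>l::nat. \<forall>u\<in>U. \<exists>!Y. is_lagrangian_spline w U (2 ^ l) \<epsilon> u Y) \<and>
    (\<forall>\<omega> f. 0 < \<omega> \<longrightarrow> \<omega> < 1 / \<Lambda> - \<epsilon> \<longrightarrow> f \<in> eigenspan w \<omega> \<longrightarrow>
      (\<lambda>l::nat. \<bar>(\<Sum>v\<in>UNIV. f $ v) - (\<Sum>u\<in>U. f $ u * theta w U (2 ^ l) \<epsilon> u)\<bar>)
        \<longlonglongrightarrow> 0)"
proof (intro conjI allI ballI impI)
  fix l :: nat and u assume "u \<in> U"
  then show "\<exists>!Y. is_lagrangian_spline w U (2 ^ l) \<epsilon> u Y"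
    using ex1_lagrangian_spline[OF assms(1,2)] assms(3) by simp
next
  fix \<omega> f assume \<omega>: "0 < \<omega>" "\<omega> < 1 / \<Lambda> - \<epsilon>" and f: "f \<in> eigenspan w \<omega>"
  let ?err = "\<lambda>l. f - (\<Sum>u\<in>U. f $ u *\<^sub>R lagrangian_spline w U (2 ^ l) \<epsilon> u)"
  have "?err \<longlonglongrightarrow> 0"
    using splines_converge_on_eigenspan[OF assms(1,2) _ \<omega> f] assms(3) by simp
  then have "(\<lambda>l. \<bar>\<Sum>v\<in>UNIV. ?err l $ v\<bar>) \<longlonglongrightarrow> \<bar>\<Sum>v\<in>(UNIV :: 'v set). 0 $ v\<bar>"
    by (intro tendsto_rabs tendsto_sum tendsto_vec_nth)
  moreover have "(\<Sum>v\<in>UNIV. ?err l $ v) =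
      (\<Sum>v\<in>UNIV. f $ v) - (\<Sum>u\<in>U. f $ u * theta w U (2 ^ l) \<epsilon> u)" for l
    using sum.swap[of "\<lambda>v u. f $ u * lagrangian_spline w U (2 ^ l) \<epsilon> u $ v" U UNIV]
    by (simp add: theta_def sum_subtractf sum_distrib_left)
  ultimately show "(\<lambda>l::nat. \<bar>(\<Sum>v\<in>UNIV. f $ v) - (\<Sum>u\<in>U. f $ u * theta w U (2 ^ l) \<epsilon> u)\<bar>)
      \<longlonglongrightarrow> 0"
    by simp
qed

end
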